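(* For $|\varepsilon|>0$ sufficiently small, the averaging method of first order predicts at most $5$ crossing limit cycles for the piecewise quadratic vector field $Z_{1,\varepsilon}$, a piecewise quadratic perturbation of the isochronous center $\dot x=-y+x^2-y^2,\ \dot y=x+2xy$, when the curve of discontinuity is the straight line $\{x=0\}$; moreover, this number is reached. That is: for every choice of the perturbation polynomials of degree at most $2$, the first averaged function $\mathcal{F}_1:(0,1)\to\mathbb{R}$ of $Z_{1,\varepsilon}$ has at most $5$ simple zeros in $(0,1)$, and there is a choice of the perturbation polynomials for which $\mathcal{F}_1$ has exactly $5$ simple zeros in $(0,1)$.
   Context: $Z_{1,\varepsilon}$ is the piecewise vector field equal to $(-y+x^2-y^2,\;x+2xy)+\varepsilon(P_1^{\pm},Q_1^{\pm})+\varepsilon^2(P_2^{\pm},Q_2^{\pm})$ on the two open half-planes (labelled $+$ and $-$) bounded by $\{x=0\}$, where $P_k^\pm,Q_k^\pm$ ($k=1,2$) are arbitrary real polynomials in $(x,y)$ of degree at most $2$. First averaged function. The birational change of variables $u=\frac{x^2+y^2+y}{x^2+y^2+2y+1}$, $v=-\frac{x}{x^2+y^2+2y+1}$, with inverse $x=-\frac{v}{v^2+(u-1)^2}$, $y=-\frac{u^2+v^2-u}{v^2+(u-1)^2}$, transforms the unperturbed center into the linear center $\dot u=-v,\ \dot v=u$ and the line $\{x=0\}$ into $\{v=0\}$. Writing $u=r\cos\theta$, $v=r\sin\theta$ and taking $\theta$ as independent variable, $Z_{1,\varepsilon}$ becomes $\frac{dr}{d\theta}=\varepsilon F_1(\theta,r)+O(\varepsilon^2)$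 for $r\in(0,1)$, where $F_1$ is $2\pi$-periodic in $\theta$ and given by one analytic expression for $\theta\in(0,\pi)$ and another for $\theta\in(-\pi,0)$. The first averaged function is $\mathcal{F}_1(r)=\int_{-\pi}^{\pi}F_1(\theta,r)\,d\theta$, $r\in(0,1)$. A simple zero is $\rho$ with $\mathcal{F}_1(\rho)=0$ and $\mathcal{F}_1'(\rho)\ne0$. Each simple zero $\rho$ gives, for $|\varepsilon|>0$ small, a $2\pi$-periodic solution $r(\theta,\varepsilon)$ with $r(0,\varepsilon)\to\rho$ as $\varepsilon\to0$ (a crossing limit cycle); the number of limit cycles predicted by the averaging method of first order is the number of simple zeros of $\mathcal{F}_1$. *)

theory Defs
  imports "HOL-Analysis.Analysis"
begin

type_synonym vfield = "real \<times> real \<Rightarrow> real \<times> real"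

definition quadratic_polynomial :: "(real \<times> real \<Rightarrow> real) \<Rightarrow> bool" where
  "quadratic_polynomial f \<longleftrightarrow>
     (\<exists>a :: nat \<Rightarrow> nat \<Rightarrow> real. \<forall>x y. f (x, y) = (\<Sum>i\<le>2. \<Sum>j\<le>2 - i. a i j * x ^ i * y ^ j))"

(* X stands for a pair (P, Q) of polynomials of degree at most 2. *)
definition quadratic_field :: "vfield \<Rightarrow> bool" where
  "quadratic_field X \<longleftrightarrow>
     quadratic_polynomial (\<lambda>p. fst (X p)) \<and> quadratic_polynomial (\<lambda>p. snd (X p))"

definition center_field :: vfield where
  "center_field = (\<lambda>(x, y). (- y + x\<^sup>2 - y\<^sup>2, x + 2 * x * y))"

(* The label + is given to {x > 0}.  The value on the line {x = 0} is immaterial: in the polar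
   angle below it only concerns the integrand of the averaged function at -pi, 0 and pi. *)
definition Z1 :: "vfield \<Rightarrow> vfield \<Rightarrow> vfield \<Rightarrow> vfield \<Rightarrow> real \<Rightarrow> vfield" where
  "Z1 X1p X1m X2p X2m \<epsilon> p =
     center_field p +
     (if fst p > 0 then \<epsilon> *\<^sub>R X1p p + \<epsilon>\<^sup>2 *\<^sub>R X2p p else \<epsilon> *\<^sub>R X1m p + \<epsilon>\<^sup>2 *\<^sub>R X2m p)"

definition to_uv :: "real \<times> real \<Rightarrow> real \<times> real" where
  "to_uv = (\<lambda>(x, y). ((x\<^sup>2 + y\<^sup>2 + y) / (x\<^sup>2 + y\<^sup>2 + 2 * y + 1),
                      - x / (x\<^sup>2 + y\<^sup>2 + 2 * y + 1)))"

definition from_uv :: "real \<times> real \<Rightarrow> real \<times> real" where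
  "from_uv = (\<lambda>(u, v). (- v / (v\<^sup>2 + (u - 1)\<^sup>2),
                        - (u\<^sup>2 + v\<^sup>2 - u) / (v\<^sup>2 + (u - 1)\<^sup>2)))"

definition field_uv :: "vfield \<Rightarrow> vfield" where
  "field_uv Z q = frechet_derivative to_uv (at (from_uv q)) (Z (from_uv q))"

(* For W = (u', v') at u = r cos \<theta>, v = r sin \<theta>:
   r' = cos \<theta> u' + sin \<theta> v' and \<theta>' = (cos \<theta> v' - sin \<theta> u') / r. *)
definition polar_slope :: "vfield \<Rightarrow> real \<Rightarrow> real \<Rightarrow> real" where
  "polar_slope W \<theta> r =
     (let (u', v') = W (r * cos \<theta>, r * sin \<theta>)
      in (cos \<theta> * u' + sin \<theta> * v') / ((cos \<theta> * v' - sin \<theta> * u') / r))"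

definition drdtheta ::
  "vfield \<Rightarrow> vfield \<Rightarrow> vfield \<Rightarrow> vfield \<Rightarrow> real \<Rightarrow> real \<Rightarrow> real \<Rightarrow> real" where
  "drdtheta X1p X1m X2p X2m \<epsilon> \<theta> r = polar_slope (field_uv (Z1 X1p X1m X2p X2m \<epsilon>)) \<theta> r"

(* The coefficient of \<epsilon> in dr/d\<theta>, the term of order 0 being zero;
   see drdtheta_has_derivative below. *)
definition F1 ::
  "vfield \<Rightarrow> vfield \<Rightarrow> vfield \<Rightarrow> vfield \<Rightarrow> real \<Rightarrow> real \<Rightarrow> real" where
  "F1 X1p X1m X2p X2m \<theta> r = deriv (\<lambda>\<epsilon>. drdtheta X1p X1m X2p X2m \<epsilon> \<theta> r) 0"

definition averaged1 :: "vfield \<Rightarrow> vfield \<Rightarrow> vfield \<Rightarrow> vfield \<Rightarrow> real \<Rightarrow> real" where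
  "averaged1 X1p X1m X2p X2m r = integral {-pi..pi} (\<lambda>\<theta>. F1 X1p X1m X2p X2m \<theta> r)"

definition simple_zeros :: "(real \<Rightarrow> real) \<Rightarrow> real set" where
  "simple_zeros f =
     {\<rho> \<in> {0<..<1}. f \<rho> = 0 \<and> (\<exists>D. (f has_real_derivative D) (at \<rho>) \<and> D \<noteq> 0)}"

lemma den_uv_nonzero: "v\<^sup>2 + (u - 1)\<^sup>2 \<noteq> 0" if "(u, v) \<noteq> (1, 0)" for u v :: real
  using that by (auto simp: sum_power2_eq_zero_iff)

lemma den_xy: "x\<^sup>2 + y\<^sup>2 + 2 * y + 1 = x\<^sup>2 + (y + 1)\<^sup>2" for x y :: real
  by (simp add: power2_eq_square algebra_simps)

lemma den_xy_nonzero: "x\<^sup>2 + y\<^sup>2 + 2 * y + 1 \<noteq> 0" if "(x, y) \<noteq> (0, -1)" for x y :: real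
  using that unfolding den_xy by (auto simp: sum_power2_eq_zero_iff)

lemma from_uv_avoids_pole: "from_uv q \<noteq> (0, -1)" if "q \<noteq> (1, 0)"
proof (cases q)
  case (Pair u v)
  show ?thesis
  proof
    assume "from_uv q = (0, -1)"
    then have "v = 0" and "u\<^sup>2 + v\<^sup>2 - u = v\<^sup>2 + (u - 1)\<^sup>2"
      using that den_uv_nonzero[of u v] by (auto simp: Pair from_uv_def divide_simps split: if_splits)
    then have "u = 1" by (simp add: power2_eq_square algebra_simps)
    with \<open>v = 0\<close> Pair that show False by simp
  qed
qed

lemma to_uv_from_uv: "to_uv (from_uv q) = q" if "q \<noteq> (1, 0)"
proof (cases q)
  case (Pair u v)
  define d where "d = v\<^sup>2 + (u - 1)\<^sup>2"
  have d: "d \<noteq> 0" using den_uv_nonzero[of u v] that Pair by (simp add: d_def)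
  define x y where "x = - v / d" and "y = - (u\<^sup>2 + v\<^sup>2 - u) / d"
  have y1: "y + 1 = (1 - u) / d"
    using d unfolding y_def by (simp add: divide_simps) (simp add: d_def power2_eq_square algebra_simps)
  have "x\<^sup>2 + (y + 1)\<^sup>2 = (v\<^sup>2 + (1 - u)\<^sup>2) / d\<^sup>2"
    unfolding y1 x_def by (simp add: power_divide add_divide_distrib)
  also have "v\<^sup>2 + (1 - u)\<^sup>2 = d" by (simp add: d_def power2_eq_square algebra_simps)
  finally have D: "x\<^sup>2 + y\<^sup>2 + 2 * y + 1 = 1 / d"
    unfolding den_xy using d by (simp add: power2_eq_square[of d])
  have "x\<^sup>2 + y\<^sup>2 + y = 1 / d - (y + 1)" using D by simp
  also have "\<dots> = u / d" unfolding y1 by (simp add: diff_divide_distrib)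
  finally have N: "x\<^sup>2 + y\<^sup>2 + y = u / d" .
  have "from_uv q = (x, y)" by (simp add: from_uv_def Pair x_def y_def d_def)
  then have "to_uv (from_uv q) = ((u / d) / (1 / d), - x / (1 / d))"
    by (simp only: to_uv_def prod.case D N)
  then show ?thesis using d by (simp add: Pair x_def)
qed

lemma to_uv_has_derivative:
  assumes "(x, y) \<noteq> (0, -1)"
  defines "d \<equiv> x\<^sup>2 + (y + 1)\<^sup>2"
  defines "a \<equiv> 2 * x * (y + 1) / d\<^sup>2"
  defines "b \<equiv> ((y + 1)\<^sup>2 - x\<^sup>2) / d\<^sup>2"
  shows "(to_uv has_derivative (\<lambda>(h, k). (a * h + b * k, a * k - b * h))) (at (x, y))"
proof -
  have nz: "d \<noteq> 0" "x\<^sup>2 + y\<^sup>2 + 2 * y + 1 = d"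
    using den_xy_nonzero[OF assms(1)] by (simp_all add: den_xy d_def)
  have eq: "to_uv = (\<lambda>p. (((fst p)\<^sup>2 + (snd p)\<^sup>2 + snd p) / ((fst p)\<^sup>2 + (snd p)\<^sup>2 + 2 * snd p + 1),
                      - fst p / ((fst p)\<^sup>2 + (snd p)\<^sup>2 + 2 * snd p + 1)))"
    by (auto simp: to_uv_def)
  have e: "x\<^sup>2 + y\<^sup>2 + y = d - (y + 1)" using nz(2) by simp
  have u: "((\<lambda>p. ((fst p)\<^sup>2 + (snd p)\<^sup>2 + snd p) / ((fst p)\<^sup>2 + (snd p)\<^sup>2 + 2 * snd p + 1))
      has_derivative (\<lambda>p. a * fst p + b * snd p)) (at (x, y))"
    apply (rule derivative_eq_intros refl | simp add: nz)+
    apply (rule ext)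
    using nz(1) apply (simp add: e a_def b_def divide_simps)
    apply (simp add: d_def power2_eq_square algebra_simps)
    done
  have v: "((\<lambda>p. - fst p / ((fst p)\<^sup>2 + (snd p)\<^sup>2 + 2 * snd p + 1))
      has_derivative (\<lambda>p. a * snd p - b * fst p)) (at (x, y))"
    apply (rule derivative_eq_intros refl | simp add: nz)+
    apply (rule ext)
    using nz(1) apply (simp add: a_def b_def divide_simps)
    apply (simp add: d_def power2_eq_square algebra_simps)
    done
  show ?thesis
    using has_derivative_Pair[OF u v] by (simp add: eq case_prod_unfold)
qed

lemma field_uv_center: "field_uv center_field (u, v) = (- v, u)" if "(u, v) \<noteq> (1, 0)"
proof -
  obtain x y where xy: "from_uv (u, v) = (x, y)" by fastforce
  have ne: "(x, y) \<noteq> (0, -1)" using from_uv_avoids_pole[OF that] xy by simp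
  define d where "d = x\<^sup>2 + (y + 1)\<^sup>2"
  have nz: "d \<noteq> 0" using den_xy_nonzero[OF ne] by (simp add: den_xy d_def)
  have uv: "u = (x\<^sup>2 + y\<^sup>2 + y) / d" "v = - x / d"
    using to_uv_from_uv[OF that] unfolding xy by (simp_all add: to_uv_def den_xy d_def)
  show ?thesis
    unfolding field_uv_def xy frechet_derivative_at[OF to_uv_has_derivative[OF ne], symmetric]
    unfolding center_field_def uv d_def[symmetric]
    using nz by (simp add: divide_simps) (simp add: d_def power2_eq_square algebra_simps)
qed

lemma field_uv_Z1:
  assumes "(u, v) \<noteq> (1, 0)"
  obtains A B where "\<And>\<epsilon>. field_uv (Z1 X1p X1m X2p X2m \<epsilon>) (u, v) = (- v, u) + \<epsilon> *\<^sub>R A + \<epsilon>\<^sup>2 *\<^sub>R B"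
    and "A = field_uv (if v < 0 then X1p else X1m) (u, v)"
proof -
  define p where "p = from_uv (u, v)"
  let ?L = "frechet_derivative to_uv (at p)"
  have "to_uv differentiable (at p)"
    using to_uv_has_derivative[of "fst p" "snd p"] from_uv_avoids_pole[OF assms]
    by (auto simp: differentiable_def p_def)
  then have lin: "linear ?L" by (rule linear_frechet_derivative)
  have "fst p > 0 \<longleftrightarrow> v < 0"
    using den_uv_nonzero[OF assms] by (auto simp: p_def from_uv_def zero_less_divide_iff sum_power2_gt_zero_iff add_pos_nonneg not_sum_power2_lt_zero divide_less_0_iff)
  moreover have "?L (center_field p) = (- v, u)"
    using field_uv_center[OF assms] by (simp add: field_uv_def p_def)
  ultimately have "field_uv (Z1 X1p X1m X2p X2m \<epsilon>) (u, v) = (- v, u)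
      + \<epsilon> *\<^sub>R ?L ((if v < 0 then X1p else X1m) p) + \<epsilon>\<^sup>2 *\<^sub>R ?L ((if v < 0 then X2p else X2m) p)" for \<epsilon>
    unfolding field_uv_def p_def[symmetric] Z1_def
    by (simp add: linear_add[OF lin] linear_scale[OF lin])
  then show ?thesis by (rule that) (simp add: field_uv_def p_def)
qed

lemma drdtheta_has_derivative:
  assumes "r \<in> {0<..<1}"
  shows "drdtheta X1p X1m X2p X2m 0 \<theta> r = 0"
    and "((\<lambda>\<epsilon>. drdtheta X1p X1m X2p X2m \<epsilon> \<theta> r) has_real_derivative F1 X1p X1m X2p X2m \<theta> r) (at 0)"
    and "F1 X1p X1m X2p X2m \<theta> r =
           (let (U, V) = field_uv (if sin \<theta> < 0 then X1p else X1m) (r * cos \<theta>, r * sin \<theta>)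
            in cos \<theta> * U + sin \<theta> * V)"
proof -
  define c s where "c = cos \<theta>" and "s = sin \<theta>"
  have cs: "c * c + s * s = 1"
    using sin_cos_squared_add3 by (simp add: c_def s_def)
  have "r * c \<le> r * 1"
    unfolding c_def by (rule mult_left_mono) (use assms in auto)
  also have "r * 1 < 1" using assms by simp
  finally have "(r * c, r * s) \<noteq> (1, 0)" by (metis fst_conv less_irrefl)
  then obtain A B where *: "\<And>\<epsilon>. field_uv (Z1 X1p X1m X2p X2m \<epsilon>) (r * c, r * s)
        = (- (r * s), r * c) + \<epsilon> *\<^sub>R A + \<epsilon>\<^sup>2 *\<^sub>R B"
    and A: "A = field_uv (if r * s < 0 then X1p else X1m) (r * c, r * s)"
    by (rule field_uv_Z1[where ?X1p = X1p and ?X1m = X1m and ?X2p = X2p and ?X2m = X2m]) blast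
  have rs: "r * s < 0 \<longleftrightarrow> s < 0" using assms by (simp add: mult_less_0_iff)
  define a b a' b' where "a = c * fst A + s * snd A" and "b = c * fst B + s * snd B"
    and "a' = (c * snd A - s * fst A) / r" and "b' = (c * snd B - s * fst B) / r"
  have num: "c * (- (r * s) + \<epsilon> * fst A + \<epsilon>\<^sup>2 * fst B) + s * (r * c + \<epsilon> * snd A + \<epsilon>\<^sup>2 * snd B)
      = \<epsilon> * a + \<epsilon>\<^sup>2 * b" for \<epsilon>
    by (simp add: a_def b_def algebra_simps)
  have den: "(c * (r * c + \<epsilon> * snd A + \<epsilon>\<^sup>2 * snd B) - s * (- (r * s) + \<epsilon> * fst A + \<epsilon>\<^sup>2 * fst B)) / r
      = 1 + \<epsilon> * a' + \<epsilon>\<^sup>2 * b'" for \<epsilon>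
  proof -
    have "c * (r * c + \<epsilon> * snd A + \<epsilon>\<^sup>2 * snd B) - s * (- (r * s) + \<epsilon> * fst A + \<epsilon>\<^sup>2 * fst B)
        = r * (c * c + s * s) + \<epsilon> * (c * snd A - s * fst A) + \<epsilon>\<^sup>2 * (c * snd B - s * fst B)"
      by (simp add: algebra_simps)
    then show ?thesis using assms by (simp add: cs a'_def b'_def add_divide_distrib)
  qed
  have eq: "drdtheta X1p X1m X2p X2m \<epsilon> \<theta> r = (\<epsilon> * a + \<epsilon>\<^sup>2 * b) / (1 + \<epsilon> * a' + \<epsilon>\<^sup>2 * b')" for \<epsilon>
    unfolding drdtheta_def polar_slope_def c_def[symmetric] s_def[symmetric] *
    by (simp only: Let_def case_prod_unfold fst_add snd_add fst_conv snd_conv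
        fst_scaleR snd_scaleR real_scaleR_def num den)
  then show "drdtheta X1p X1m X2p X2m 0 \<theta> r = 0" by simp
  have D: "((\<lambda>\<epsilon>. drdtheta X1p X1m X2p X2m \<epsilon> \<theta> r) has_real_derivative a) (at 0)"
    unfolding eq by (auto intro!: derivative_eq_intros)
  then have F: "F1 X1p X1m X2p X2m \<theta> r = a" by (simp add: F1_def DERIV_imp_deriv)
  show "((\<lambda>\<epsilon>. drdtheta X1p X1m X2p X2m \<epsilon> \<theta> r) has_real_derivative F1 X1p X1m X2p X2m \<theta> r) (at 0)"
    using D F by simp
  show "F1 X1p X1m X2p X2m \<theta> r =
           (let (U, V) = field_uv (if sin \<theta> < 0 then X1p else X1m) (r * cos \<theta>, r * sin \<theta>)
            in cos \<theta> * U + sin \<theta> * V)"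
    unfolding F a_def A rs by (simp add: c_def s_def case_prod_unfold Let_def)
qed

end

theory Submission
  imports Defs
begin



text \<open>
  In the complex coordinates \<open>z = x + i y\<close> and \<open>w = u + i v\<close> the change of variables is the Moebius
  map \<open>w = z / (z + i)\<close>. It transports a planar vector field, read as a complex-valued function \<open>X(z)\<close>,
  to \<open>- i (1 - w)\<^sup>2 X(i w / (1 - w))\<close>. The first averaged function is therefore the integral of the
  real part of \<open>e\<^sup>-\<^sup>i\<^sup>\<theta>\<close> times this expression along the circle \<open>w = r e\<^sup>i\<^sup>\<theta>\<close>, each half of the
  circle carrying its own quadratic polynomial in \<open>z\<close> and its conjugate. On the circle \<open>w\<close> times its
  conjugate \<open>t\<close> is \<open>r\<^sup>2\<close>, so partial fractions reduce the integrand to a combination of \<open>1\<close>, \<open>t\<close>,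
  \<open>w\<close>, \<open>1/(1 - t)\<close> and \<open>1/(1 - t)\<^sup>2\<close>, all with elementary primitives
  (lemmas \<open>radial_component_expansion\<close> and \<open>half_circle_integrals\<close>).

  The outcome (lemmas \<open>averaged1_eq_log_model\<close> and \<open>log_model_is_averaged1\<close>) is that, up to the
  positive factor \<open>(1 - r\<^sup>2) / r\<close>, the averaged functions are exactly the combinations of the six functions
  \<open>r/(1 - r\<^sup>2)\<close>, \<open>r\<^sup>2/(1 - r\<^sup>2)\<close>, \<open>r\<close>, \<open>r\<^sup>2\<close>, \<open>L\<close>, \<open>r\<^sup>2 L\<close> with \<open>L = ln ((1 + r)/(1 - r))\<close>.
  Everything then follows from one zero count. All six functions vanish at \<open>0\<close>, which provides an
  additional zero. Three derivatives remove both the logarithm and the quadratic part, and leave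
  \<open>q(r)/(1 - r\<^sup>2)\<^sup>4\<close> with a polynomial \<open>q\<close> of degree at most four in which \<open>r\<close> and \<open>r\<^sup>3\<close> have the same
  coefficient. By Vieta, such a nonzero \<open>q\<close> cannot have four roots in \<open>(0,1)\<close>: up to the same factor
  these coefficients are the sum of the roots and the sum of their triple products, and the second sum
  is strictly smaller than the first. By Rolle, a combination with six zeros in \<open>(0,1)\<close> vanishes
  identically, and then it has no simple zero. This is the upper bound.

  For the lower bound, six coefficients leave room for a nontrivial combination vanishing at five given
  points. If one of these zeros were not simple, it would be a sixth zero of the derivative, besides
  the five that Rolle places between \<open>0\<close> and the zeros, and the same count would force
  the combination to be trivial.
\<close>

section \<open>Zeros of a function and of its derivative\<close>

text \<open>
  Rolle's theorem applied between consecutive zeros. The new zeros lie strictly between consecutive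
  elements of \<open>S\<close>, hence outside \<open>S\<close>; this is what allows a multiple zero of \<open>f\<close> to be counted in
  addition to them.
\<close>

lemma Rolle_finite_set:
  fixes f f' :: "real \<Rightarrow> real"
  assumes "finite S" "card S = Suc n" "S \<subseteq> {l<..<u}" "\<forall>x\<in>S. f x = 0"
    and f': "\<And>x. x \<in> {l<..<u} \<Longrightarrow> (f has_real_derivative f' x) (at x)"
  shows "\<exists>T. finite T \<and> card T = n \<and> T \<inter> S = {} \<and> (\<forall>x\<in>T. f' x = 0)
           \<and> (\<forall>x\<in>T. \<exists>a\<in>S. \<exists>b\<in>S. a < x \<and> x < b)"
  using assms(1-4)
proof (induction n arbitrary: S)
  case 0
  then show ?case by (intro exI[of _ "{}"]) auto
next
  case (Suc n)
  define M where "M = Max S"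
  define S' where "S' = S - {M}"
  define m where "m = Max S'"
  have "S \<noteq> {}" using Suc.prems by auto
  then have M: "M \<in> S" and leM: "\<And>x. x \<in> S \<Longrightarrow> x \<le> M"
    using Suc.prems by (auto simp: M_def)
  have S': "finite S'" "card S' = Suc n" "S' \<subseteq> S"
    using Suc.prems M by (auto simp: S'_def)
  then have "S' \<noteq> {}" by auto
  then have m: "m \<in> S'" and lem: "\<And>x. x \<in> S' \<Longrightarrow> x \<le> m"
    using S' by (auto simp: m_def)
  have "m < M" using m leM[of m] by (auto simp: S'_def)
  obtain T where T: "finite T" "card T = n" "T \<inter> S' = {}" "\<forall>x\<in>T. f' x = 0"
    and btw: "\<forall>x\<in>T. \<exists>a\<in>S'. \<exists>b\<in>S'. a < x \<and> x < b"
    using Suc.IH[of S'] S' Suc.prems by blast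
  have sub: "x \<in> {l<..<u}" if "m \<le> x" "x \<le> M" for x
    using that M m S' Suc.prems(3) by fastforce
  have "\<exists>y. m < y \<and> y < M \<and> (\<lambda>v. v * f' y) = (\<lambda>v. 0)"
  proof (rule Rolle_deriv[OF \<open>m < M\<close>])
    show "f m = f M" using m M S' Suc.prems(4) by auto
    show "continuous_on {m..M} f"
      by (intro continuous_at_imp_continuous_on ballI DERIV_isCont[OF f'] sub) auto
    show "(f has_derivative (\<lambda>v. v * f' y)) (at y)" if "m < y" "y < M" for y
      using f'[OF sub[of y]] that by (simp add: has_field_derivative_def mult_commute_abs)
  qed
  then obtain y where y: "m < y" "y < M" "f' y = 0" by (metis mult_1)
  have "x < m" if "x \<in> T" for x using btw that lem by (metis less_le_trans)
  moreover have "y \<notin> S" using y lem[of y] by (auto simp: S'_def)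
  moreover have "M \<notin> T" using calculation(1) \<open>m < M\<close> by fastforce
  moreover have "y \<notin> T" using calculation(1) y(1) by fastforce
  ultimately have "finite (insert y T)" "card (insert y T) = Suc n" "insert y T \<inter> S = {}"
    using T y(1) by (auto simp: S'_def)
  moreover have "\<forall>x\<in>insert y T. \<exists>a\<in>S. \<exists>b\<in>S. a < x \<and> x < b"
    using btw y m M S'(3) by (metis insert_iff subsetD)
  ultimately show ?case using T(4) y(3) by (intro exI[of _ "insert y T"]) auto
qed

text \<open>
  With four roots the polynomial is \<open>c4\<close> times the product of the linear factors, so it vanishes as soon
  as \<open>c4 = 0\<close>. If \<open>c4\<close> were nonzero, the equality of the coefficients of \<open>x\<close> and \<open>x\<^sup>3\<close>
  would equate the elementary symmetric functions \<open>e\<^sub>1\<close> and \<open>e\<^sub>3\<close> of the four roots. But a triple product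
  of numbers in \<open>(0,1)\<close> is smaller than each of its factors, and four triple products can be matched with
  four different factors, so \<open>e\<^sub>3 < e\<^sub>1\<close>.
\<close>

lemma quartic_four_unit_roots_zero:
  fixes c0 c1 c2 c4 :: real
  assumes "card T = 4" "T \<subseteq> {0<..<1}"
    and "\<forall>x\<in>T. c0 + c1 * x + c2 * x ^ 2 + c1 * x ^ 3 + c4 * x ^ 4 = 0"
  shows "c0 = 0 \<and> c1 = 0 \<and> c2 = 0 \<and> c4 = 0"
proof -
  obtain p q r s where T: "T = {p, q, r, s}"
    using assms(1) by (auto simp: card_Suc_eq eval_nat_numeral)
  define P where "P = [:c0, c1, c2, c1, c4:]"
  define Q where "Q = smult c4 ([:-p, 1:] * [:-q, 1:] * [:-r, 1:] * [:-s, 1:])"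
  have "P = Q"
  proof (rule poly_eqI_degree_lead_coeff[where n = 4 and A = T])
    show "poly P z = poly Q z" if "z \<in> T" for z
    proof -
      have "poly Q z = 0" using that by (auto simp only: Q_def T poly_smult poly_mult) auto
      moreover have "poly P z = 0"
        using bspec[OF assms(3) that] by (simp add: P_def algebra_simps eval_nat_numeral)
      ultimately show ?thesis by simp
    qed
  qed (use assms(1) in \<open>auto simp: P_def Q_def eval_nat_numeral\<close>)
  then have e3: "c1 = - c4 * (p * q * r + p * q * s + p * r * s + q * r * s)" and e1: "c1 = - c4 * (p + q + r + s)"
    and c0: "c0 = c4 * (p * q * r * s)" and c2: "c2 = c4 * (p * q + p * r + p * s + q * r + q * s + r * s)"
    by (simp_all add: P_def Q_def algebra_simps)
  have less: "x * y * z < x" if "x \<in> {0<..<1}" "y \<in> {0<..<1}" "z \<in> {0<..<1}" for x y z :: real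
  proof -
    have "y * z < 1 * 1" using that by (intro mult_strict_mono) auto
    then have "x * (y * z) < x * 1" using that by (intro mult_strict_left_mono) auto
    then show ?thesis by (simp add: mult.assoc)
  qed
  \<comment> \<open>Each triple product is compared with its first factor.\<close>
  have "p * q * r + q * r * s + r * s * p + s * p * q < p + q + r + s"
    by (intro add_strict_mono less) (use assms(2) T in auto)
  moreover have "c4 * (p * q * r + q * r * s + r * s * p + s * p * q) = c4 * (p + q + r + s)"
    using e1 e3 by (simp add: algebra_simps)
  ultimately have "c4 = 0" by auto
  then show ?thesis using e1 c0 c2 by simp
qed

section \<open>The six-parameter family of averaged functions\<close>

text \<open>
  This is the averaged function divided by \<open>(1 - r\<^sup>2)/r\<close>. After this division the logarithm has only the
  polynomial coefficient \<open>a + b r\<^sup>2\<close>, so that three derivatives make it rational, and the function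
  extends analytically to \<open>(-1,1)\<close> with a zero at \<open>0\<close>.
\<close>

definition log_model :: "real \<Rightarrow> real \<Rightarrow> real \<Rightarrow> real \<Rightarrow> real \<Rightarrow> real \<Rightarrow> real \<Rightarrow> real" where
  "log_model A B C D a b r =
     A * (r / (1 - r\<^sup>2)) + B * (r\<^sup>2 / (1 - r\<^sup>2)) + C * r + D * r\<^sup>2
     + (a + b * r\<^sup>2) * (ln (1 + r) - ln (1 - r))"

definition log_model' where
  "log_model' A B C D a b r =
     A * (1 + r\<^sup>2) / (1 - r\<^sup>2) ^ 2 + B * (2 * r) / (1 - r\<^sup>2) ^ 2 + C + 2 * D * r
     + 2 * b * r * (ln (1 + r) - ln (1 - r)) + 2 * (a + b * r\<^sup>2) / (1 - r\<^sup>2)" for r :: real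

definition log_model'' where
  "log_model'' A B D a b r =
     A * (2 * r * (3 + r\<^sup>2)) / (1 - r\<^sup>2) ^ 3 + B * (2 + 6 * r\<^sup>2) / (1 - r\<^sup>2) ^ 3 + 2 * D
     + 2 * b * (ln (1 + r) - ln (1 - r))
     + 8 * b * r / (1 - r\<^sup>2) + 4 * r * (a + b * r\<^sup>2) / (1 - r\<^sup>2) ^ 2" for r :: real

text \<open>The numerator of the third derivative over the common denominator \<open>(1 - r\<^sup>2)\<^sup>4\<close>.\<close>

definition log_model_quartic where
  "log_model_quartic A B a b r =
     (6 * A + 4 * (a + 3 * b)) + 24 * B * r + (36 * A + 8 * a - 8 * b) * r ^ 2
     + 24 * B * r ^ 3 + (6 * A - 4 * (3 * a + b)) * r ^ 4" for r :: real

lemma one_minus_power2_pos: "1 - r\<^sup>2 > 0" if "r \<in> {-1<..<1}" for r :: real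
  using that abs_square_less_1[of r] by auto

lemma ln_diff_deriv:
  assumes "r \<in> {-1<..<1}"
  shows "((\<lambda>r. ln (1 + r) - ln (1 - r)) has_real_derivative 2 / (1 - r\<^sup>2)) (at r)"
  using assms by (auto intro!: derivative_eq_intros simp: divide_simps power2_eq_square algebra_simps)

lemma log_model_deriv:
  assumes "r \<in> {-1<..<1}"
  shows "(log_model A B C D a b has_real_derivative log_model' A B C D a b r) (at r)"
proof -
  define k where "k = 1 - r\<^sup>2"
  have k: "k > 0" using one_minus_power2_pos[OF assms] by (simp add: k_def)
  note L = ln_diff_deriv[OF assms]
  show ?thesis
    unfolding log_model_def[abs_def] log_model'_def k_def[symmetric]
    apply (rule L derivative_eq_intros refl | use k in \<open>simp add: k_def; fail\<close>)+
    using k apply (simp add: k_def[symmetric] divide_simps)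
    apply (simp add: k_def)
    apply algebra
    done
qed

lemma log_model'_deriv:
  assumes "r \<in> {-1<..<1}"
  shows "(log_model' A B C D a b has_real_derivative log_model'' A B D a b r) (at r)"
proof -
  define k where "k = 1 - r\<^sup>2"
  have k: "k > 0" using one_minus_power2_pos[OF assms] by (simp add: k_def)
  note L = ln_diff_deriv[OF assms]
  show ?thesis
    unfolding log_model''_def log_model'_def[abs_def] k_def[symmetric]
    apply (rule L derivative_eq_intros refl | use k in \<open>simp add: k_def; fail\<close>)+
    using k apply (simp add: k_def[symmetric] divide_simps)
    apply (simp add: k_def)
    apply algebra
    done
qed

lemma log_model''_deriv:
  assumes "r \<in> {-1<..<1}"
  shows "(log_model'' A B D a b has_real_derivative log_model_quartic A B a b r / (1 - r\<^sup>2) ^ 4) (at r)"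
proof -
  define k where "k = 1 - r\<^sup>2"
  have k: "k > 0" using one_minus_power2_pos[OF assms] by (simp add: k_def)
  note L = ln_diff_deriv[OF assms]
  show ?thesis
    unfolding log_model''_def[abs_def] k_def[symmetric] log_model_quartic_def
    apply (rule L derivative_eq_intros refl | use k in \<open>simp add: k_def; fail\<close>)+
    using k apply (simp add: k_def[symmetric] divide_simps)
    apply (simp add: k_def)
    apply algebra
    done
qed

text \<open>
  Two more applications of Rolle's theorem give four roots of the quartic in \<open>(0,1)\<close>, so the quartic
  vanishes. Its coefficients determine all parameters except \<open>C\<close> and \<open>D\<close>; with the other
  parameters zero, the first derivative is affine and has more than one zero.
\<close>

lemma log_model_six_critical_points:
  assumes T: "finite T" "card T = 6" "T \<subseteq> {0<..<1}" "\<forall>x\<in>T. log_model' A B C D a b x = 0"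
  shows "A = 0 \<and> B = 0 \<and> C = 0 \<and> D = 0 \<and> a = 0 \<and> b = 0"
proof -
  have sub: "T \<subseteq> {-1<..<1}" using T by auto
  obtain T2 where T2: "finite T2" "card T2 = 5" "\<forall>x\<in>T2. log_model'' A B D a b x = 0"
    "\<forall>x\<in>T2. \<exists>a\<in>T. \<exists>b\<in>T. a < x \<and> x < b"
    using Rolle_finite_set[of T 5 "-1" 1, OF _ _ sub T(4) log_model'_deriv] T by auto
  have T2s: "T2 \<subseteq> {0<..<1}" using T(3) T2(4) by fastforce
  then have "T2 \<subseteq> {-1<..<1}" by auto
  then obtain T3 where T3: "card T3 = 4"
    "\<forall>x\<in>T3. log_model_quartic A B a b x / (1 - x\<^sup>2) ^ 4 = 0"
    "\<forall>x\<in>T3. \<exists>a\<in>T2. \<exists>b\<in>T2. a < x \<and> x < b"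
    using Rolle_finite_set[of T2 4 "-1" 1, OF _ _ _ T2(3) log_model''_deriv] T2 by auto
  have T3s: "T3 \<subseteq> {0<..<1}" using T2s T3(3) by fastforce
  have "\<forall>x\<in>T3. log_model_quartic A B a b x = 0"
  proof
    fix x assume x: "x \<in> T3"
    then have "1 - x\<^sup>2 > 0" using T3s by (intro one_minus_power2_pos) auto
    then show "log_model_quartic A B a b x = 0" using bspec[OF T3(2) x] by simp
  qed
  from quartic_four_unit_roots_zero[OF T3(1) T3s this[unfolded log_model_quartic_def]]
  have z: "A = 0" "B = 0" "a = 0" "b = 0" by auto
  have "\<not> T \<subseteq> {x}" for x
    using card_mono[of "{x}" T] T(2) by auto
  then obtain x y where xy: "x \<in> T" "y \<in> T" "x \<noteq> y" by blast
  have "C + 2 * D * x = 0" "C + 2 * D * y = 0"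
    using T(4) xy z by (auto simp: log_model'_def)
  moreover have "2 * D * (x - y) = (C + 2 * D * x) - (C + 2 * D * y)" by (simp add: algebra_simps)
  ultimately have "2 * D * (x - y) = 0" by simp
  then show ?thesis using xy z \<open>C + 2 * D * x = 0\<close> by simp
qed

lemma log_model_0 [simp]: "log_model A B C D a b 0 = 0"
  by (simp add: log_model_def)

text \<open>
  The zero at \<open>0\<close> compensates the loss of one zero in Rolle's theorem: the derivative has as many
  zeros in \<open>(0,1)\<close> as the function.
\<close>

lemma log_model_critical_points:
  assumes S: "finite S" "card S = n" "S \<subseteq> {0<..<1}" "\<forall>x\<in>S. log_model A B C D a b x = 0"
  obtains T where "finite T" "card T = n" "T \<inter> S = {}" "T \<subseteq> {0<..<1}"
    "\<forall>x\<in>T. log_model' A B C D a b x = 0"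
proof -
  let ?S = "insert 0 S"
  have "0 \<notin> S" using S(3) by auto
  then have "card ?S = Suc n" using S(1,2) by simp
  moreover have "finite ?S" "?S \<subseteq> {-1<..<1}" using S(1,3) by auto
  moreover have "\<forall>x\<in>?S. log_model A B C D a b x = 0" using S(4) by simp
  ultimately have "\<exists>T. finite T \<and> card T = n \<and> T \<inter> ?S = {} \<and> (\<forall>x\<in>T. log_model' A B C D a b x = 0)
      \<and> (\<forall>x\<in>T. \<exists>p\<in>?S. \<exists>q\<in>?S. p < x \<and> x < q)"
    by - (rule Rolle_finite_set[of ?S n "-1" 1], assumption+, rule log_model_deriv)
  then obtain T where T: "finite T" "card T = n" "T \<inter> ?S = {}"
    "\<forall>x\<in>T. log_model' A B C D a b x = 0" "\<forall>x\<in>T. \<exists>p\<in>?S. \<exists>q\<in>?S. p < x \<and> x < q"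
    by (elim exE conjE) (rule that)
  have "x \<in> {0<..<1}" if x: "x \<in> T" for x
  proof -
    obtain p q where "p \<in> ?S" "q \<in> ?S" "p < x" "x < q" using bspec[OF T(5) x] by (elim bexE conjE) (rule that)
    moreover have "0 \<le> p" "q < 1" using calculation(1,2) S(3) by auto
    ultimately show ?thesis by simp
  qed
  then show ?thesis using T(1-4) by (intro that[of T]) auto
qed

lemma log_model_six_zeros:
  assumes "finite S" "card S = 6" "S \<subseteq> {0<..<1}" "\<forall>x\<in>S. log_model A B C D a b x = 0"
  shows "A = 0 \<and> B = 0 \<and> C = 0 \<and> D = 0 \<and> a = 0 \<and> b = 0"
  using log_model_critical_points[OF assms] log_model_six_critical_points by metis

lemma log_model_five_zeros_simple:
  assumes S: "finite S" "card S = 5" "S \<subseteq> {0<..<1}" "\<forall>x\<in>S. log_model A B C D a b x = 0"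
    and x: "x \<in> S" "log_model' A B C D a b x = 0"
  shows "A = 0 \<and> B = 0 \<and> C = 0 \<and> D = 0 \<and> a = 0 \<and> b = 0"
proof -
  obtain T where T: "finite T" "card T = 5" "T \<inter> S = {}" "T \<subseteq> {0<..<1}"
    "\<forall>x\<in>T. log_model' A B C D a b x = 0"
    using log_model_critical_points[OF S] by metis
  then have "x \<notin> T" using x(1) by auto
  show ?thesis
    by (rule log_model_six_critical_points[of "insert x T"]) (use S x T \<open>x \<notin> T\<close> in auto)
qed

text \<open>
  Five points give five homogeneous linear conditions on six coefficients; a solution is a vector
  orthogonal to the five evaluation vectors.
\<close>

lemma log_model_interpolation:
  assumes "finite S" "card S = 5"
  obtains A B C D a b where "\<not> (A = 0 \<and> B = 0 \<and> C = 0 \<and> D = 0 \<and> a = 0 \<and> b = 0)"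
    "\<forall>x\<in>S. log_model A B C D a b x = 0"
proof -
  define v :: "real \<Rightarrow> real \<times> real \<times> real \<times> real \<times> real \<times> real" where
    "v r = (let L = ln (1 + r) - ln (1 - r)
            in (r / (1 - r\<^sup>2), r\<^sup>2 / (1 - r\<^sup>2), r, r\<^sup>2, L, r\<^sup>2 * L))" for r
  have "dim (v ` S) \<le> card (v ` S)" by (rule dim_le_card') (use assms in auto)
  also have "\<dots> \<le> 5" using card_image_le[OF assms(1), of v] assms(2) by simp
  finally have "dim (v ` S) < DIM(real \<times> real \<times> real \<times> real \<times> real \<times> real)" by simp
  then obtain c where c: "c \<noteq> 0" "\<And>y. y \<in> span (v ` S) \<Longrightarrow> orthogonal c y"
    using orthogonal_to_subspace_exists by blast
  obtain A B C D a b where abc: "c = (A, B, C, D, a, b)" by (metis prod.exhaust)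
  have "log_model A B C D a b x = 0" if "x \<in> S" for x
  proof -
    have "c \<bullet> v x = 0" using c(2)[of "v x"] that by (simp add: orthogonal_def span_base)
    then show ?thesis by (simp add: abc v_def Let_def log_model_def algebra_simps)
  qed
  then show ?thesis using c(1) by (intro that[of A B C D a b]) (auto simp: abc zero_prod_def)
qed

section \<open>Vector fields in the complex coordinates\<close>

definition field_at :: "vfield \<Rightarrow> complex \<Rightarrow> complex" where
  "field_at X z = (case X (Re z, Im z) of (p, q) \<Rightarrow> Complex p q)"

text \<open>
  The two components of a quadratic field together form one complex polynomial in \<open>z\<close> and its conjugate.
  This basis, rather than monomials in \<open>x\<close> and \<open>y\<close>, is the one in which the Moebius map acts simply.
\<close>

definition quadratic_map ::
  "complex \<Rightarrow> complex \<Rightarrow> complex \<Rightarrow> complex \<Rightarrow> complex \<Rightarrow> complex \<Rightarrow> complex \<Rightarrow> complex" where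
  "quadratic_map c00 c10 c01 c20 c11 c02 z =
     c00 + c10 * z + c01 * cnj z + c20 * z\<^sup>2 + c11 * (z * cnj z) + c02 * (cnj z)\<^sup>2"

lemma quadratic_polynomial_iff:
  "quadratic_polynomial f \<longleftrightarrow> (\<exists>a b c d e g. \<forall>x y.
     f (x, y) = a + b * x + c * y + d * x\<^sup>2 + e * (x * y) + g * y\<^sup>2)" (is "_ \<longleftrightarrow> ?rhs")
proof
  assume "quadratic_polynomial f"
  then obtain a where "\<And>x y. f (x, y) = (\<Sum>i\<le>2. \<Sum>j\<le>2 - i. a i j * x ^ i * y ^ j)"
    unfolding quadratic_polynomial_def by blast
  then have "\<forall>x y. f (x, y) =
      a 0 0 + a 1 0 * x + a 0 1 * y + a 2 0 * x\<^sup>2 + a 1 1 * (x * y) + a 0 2 * y\<^sup>2"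
    by (simp add: numeral_2_eq_2 algebra_simps)
  then show ?rhs by blast
next
  assume ?rhs
  then obtain a b c d e g where
    f: "\<And>x y. f (x, y) = a + b * x + c * y + d * x\<^sup>2 + e * (x * y) + g * y\<^sup>2"
    by blast
  define h :: "nat \<Rightarrow> nat \<Rightarrow> real" where
    "h i j = [[a, c, g], [b, e], [d]] ! i ! j" for i j
  have "f (x, y) = (\<Sum>i\<le>2. \<Sum>j\<le>2 - i. h i j * x ^ i * y ^ j)" for x y
    by (simp add: f h_def numeral_2_eq_2 algebra_simps)
  then show "quadratic_polynomial f" unfolding quadratic_polynomial_def by blast
qed

lemma quadratic_field_imp_quadratic_map:
  assumes "quadratic_field X"
  obtains c00 c10 c01 c20 c11 c02 where "field_at X = quadratic_map c00 c10 c01 c20 c11 c02"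
proof -
  obtain a b c d e g where P: "\<And>x y. fst (X (x, y)) =
      a + b * x + c * y + d * x\<^sup>2 + e * (x * y) + g * y\<^sup>2"
    using assms unfolding quadratic_field_def quadratic_polynomial_iff by blast
  obtain a' b' c' d' e' g' where Q: "\<And>x y. snd (X (x, y)) =
      a' + b' * x + c' * y + d' * x\<^sup>2 + e' * (x * y) + g' * y\<^sup>2"
    using assms unfolding quadratic_field_def quadratic_polynomial_iff by blast
  have "field_at X z = quadratic_map (Complex a a')
      (Complex ((b + c') / 2) ((b' - c) / 2)) (Complex ((b - c') / 2) ((b' + c) / 2))
      (Complex ((d - g + e') / 4) ((d' - g' - e) / 4))
      (Complex ((d + g) / 2) ((d' + g') / 2))
      (Complex ((d - g - e') / 4) ((d' - g' + e) / 4)) z" for z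
    by (simp add: field_at_def case_prod_unfold P Q complex_eq_iff quadratic_map_def
        power2_eq_square field_simps)
  then show ?thesis by (intro that) auto
qed

lemma quadratic_map_imp_quadratic_field:
  assumes "field_at X = quadratic_map c00 c10 c01 c20 c11 c02"
  shows "quadratic_field X"
proof -
  have X: "Complex (fst (X (x, y))) (snd (X (x, y))) = quadratic_map c00 c10 c01 c20 c11 c02 (Complex x y)"
    for x y
    using fun_cong[OF assms, of "Complex x y"] by (simp add: field_at_def case_prod_unfold)
  show ?thesis
    unfolding quadratic_field_def quadratic_polynomial_iff
  proof (intro conjI exI allI)
    fix x y
    show "fst (X (x, y)) = Re c00 + Re (c10 + c01) * x + Im (c01 - c10) * y
        + Re (c20 + c11 + c02) * x\<^sup>2 + 2 * Im (c02 - c20) * (x * y) + Re (c11 - c20 - c02) * y\<^sup>2"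
      using arg_cong[OF X, of Re x y] by (simp add: quadratic_map_def power2_eq_square algebra_simps)
    show "snd (X (x, y)) = Im c00 + Im (c10 + c01) * x + Re (c10 - c01) * y
        + Im (c20 + c11 + c02) * x\<^sup>2 + 2 * Re (c20 - c02) * (x * y) + Im (c11 - c20 - c02) * y\<^sup>2"
      using arg_cong[OF X, of Im x y] by (simp add: quadratic_map_def power2_eq_square algebra_simps)
  qed
qed

text \<open>
  The change of variables is \<open>w = z/(z + i)\<close> with inverse \<open>z = i w/(1 - w)\<close>. The real derivative of the
  map is multiplication by its complex derivative \<open>i/(z + i)\<^sup>2 = - i (1 - w)\<^sup>2\<close>.
\<close>

lemma field_at_field_uv:
  assumes "w \<noteq> 1"
  shows "field_at (field_uv X) w = - \<i> * (1 - w)\<^sup>2 * field_at X (\<i> * w / (1 - w))"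
proof -
  define u v where "u = Re w" and "v = Im w"
  define d where "d = v\<^sup>2 + (u - 1)\<^sup>2"
  define x y where "x = Re (\<i> * w / (1 - w))" and "y = Im (\<i> * w / (1 - w))"
  have uv: "(u, v) \<noteq> (1, 0)" using assms by (auto simp: u_def v_def complex_eq_iff)
  have d: "d \<noteq> 0" using den_uv_nonzero[OF uv] by (simp add: d_def)
  have d': "(1 - u)\<^sup>2 + v\<^sup>2 = d" by (simp add: d_def power2_commute)
  have xd: "x = - v / d" and yd: "y = - (u\<^sup>2 + v\<^sup>2 - u) / d"
    using d by (simp_all add: x_def y_def Re_divide Im_divide u_def[symmetric] v_def[symmetric] d')
      (simp_all add: power2_eq_square field_simps)
  have from_uv: "from_uv (u, v) = (x, y)"
    by (simp add: from_uv_def xd yd d_def)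
  have ne: "(x, y) \<noteq> (0, -1)" using from_uv_avoids_pole[OF uv] from_uv by simp
  have y1: "y + 1 = (1 - u) / d"
    using d unfolding yd by (simp add: divide_simps) (simp add: d_def power2_eq_square algebra_simps)
  have "x\<^sup>2 + (y + 1)\<^sup>2 = ((1 - u)\<^sup>2 + v\<^sup>2) / d\<^sup>2"
    unfolding y1 xd by (simp add: power_divide add_divide_distrib)
  then have D: "x\<^sup>2 + (y + 1)\<^sup>2 = 1 / d"
    unfolding d' using d by (simp add: power2_eq_square)
  have a: "2 * x * (y + 1) / (x\<^sup>2 + (y + 1)\<^sup>2)\<^sup>2 = - 2 * v * (1 - u)"
    and b: "((y + 1)\<^sup>2 - x\<^sup>2) / (x\<^sup>2 + (y + 1)\<^sup>2)\<^sup>2 = (1 - u)\<^sup>2 - v\<^sup>2"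
    unfolding D unfolding y1 xd using d by (simp_all add: power2_eq_square field_simps)
  define h k where "h = fst (X (x, y))" and "k = snd (X (x, y))"
  have "field_uv X (u, v) =
      (- 2 * v * (1 - u) * h + ((1 - u)\<^sup>2 - v\<^sup>2) * k, - 2 * v * (1 - u) * k - ((1 - u)\<^sup>2 - v\<^sup>2) * h)"
    unfolding field_uv_def from_uv frechet_derivative_at[OF to_uv_has_derivative[OF ne], symmetric] a b
    by (simp add: case_prod_unfold h_def k_def)
  moreover have "field_at X (\<i> * w / (1 - w)) = Complex h k"
    by (simp add: field_at_def case_prod_unfold h_def k_def x_def y_def)
  ultimately show ?thesis
    by (simp add: field_at_def u_def[symmetric] v_def[symmetric] complex_eq_iff power2_eq_square algebra_simps)
qed

lemma F1_eq_Re: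
  assumes "r \<in> {0<..<1}"
  shows "F1 X1p X1m X2p X2m \<theta> r =
    Re (cis (- \<theta>) * field_at (field_uv (if sin \<theta> < 0 then X1p else X1m)) (r * cis \<theta>))"
  unfolding drdtheta_has_derivative(3)[OF assms]
  by (simp add: field_at_def case_prod_unfold Let_def)

section \<open>Integration over the half-circles\<close>

text \<open>
  On the circle of radius \<open>r\<close> the conjugate of \<open>w\<close> is \<open>t\<close> with \<open>w t = r\<^sup>2\<close>. The factor \<open>r\<close> replaces
  \<open>e\<^sup>-\<^sup>i\<^sup>\<theta>\<close> by \<open>t\<close>, and this \<open>t\<close> absorbs one power of \<open>w\<close>: what remains is a term linear in \<open>w\<close>
  and a rational function of \<open>t\<close> with its only pole at \<open>1\<close>, decomposed into partial fractions.
\<close>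

lemma radial_component_expansion:
  fixes r \<theta> :: real and t w k c00 c10 c01 c20 c11 c02 :: complex
  defines "t \<equiv> r * cis (- \<theta>)" and "w \<equiv> r * cis \<theta>" and "k \<equiv> 1 - complex_of_real (r\<^sup>2)"
  assumes r: "r \<in> {0<..<1}" and X: "field_at X = quadratic_map c00 c10 c01 c20 c11 c02"
  shows "r * (cis (- \<theta>) * field_at (field_uv X) w) =
       - \<i> * (- 2 * r\<^sup>2 * c00 + \<i> * r\<^sup>2 * c10 - \<i> * (1 - 2 * k) * c01 - r\<^sup>2 * c11 - 2 * k * c02)
     + - \<i> * (c00 + \<i> * c01 - c02) * t
     + - \<i> * (r\<^sup>2 * (c00 - \<i> * c10 - c20)) * w
     + - \<i> * (- \<i> * k\<^sup>2 * c01 + r\<^sup>2 * k * c11 + (2 * k + k\<^sup>2) * c02) / (1 - t)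
     + \<i> * k\<^sup>2 * c02 / (1 - t)\<^sup>2"
proof -
  have rt: "complex_of_real r * cis (- \<theta>) = t" by (simp add: t_def)
  have wt: "w * t = r\<^sup>2" by (simp add: t_def w_def cis_mult power2_eq_square)
  have cnjw: "cnj w = t" by (simp add: t_def w_def cis_cnj)
  have "norm t < 1" "norm w < 1" using r by (simp_all add: t_def w_def norm_mult)
  then have ne: "1 - t \<noteq> 0" "1 - w \<noteq> 0" by auto
  have z: "cnj (\<i> * w / (1 - w)) = - \<i> * t / (1 - t)" by (simp add: cnjw)
  have k: "k = 1 - w * t" by (simp add: k_def wt)
  have "r * (cis (- \<theta>) * field_at (field_uv X) w) = t * field_at (field_uv X) w"
    using rt by (simp add: mult.assoc[symmetric])
  also have "\<dots> = t * (- \<i> * (1 - w)\<^sup>2 * (c00 + c10 * (\<i> * w / (1 - w)) + c01 * (- \<i> * t / (1 - t))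
      + c20 * (\<i> * w / (1 - w))\<^sup>2 + c11 * ((\<i> * w / (1 - w)) * (- \<i> * t / (1 - t)))
      + c02 * (- \<i> * t / (1 - t))\<^sup>2))"
    using ne(2) by (subst field_at_field_uv) (auto simp: X quadratic_map_def cnjw)
  also have "\<dots> = - \<i> * (- 2 * (w * t) * c00 + \<i> * (w * t) * c10 - \<i> * (1 - 2 * k) * c01 - (w * t) * c11 - 2 * k * c02)
     + - \<i> * (c00 + \<i> * c01 - c02) * t
     + - \<i> * ((w * t) * (c00 - \<i> * c10 - c20)) * w
     + - \<i> * (- \<i> * k\<^sup>2 * c01 + (w * t) * k * c11 + (2 * k + k\<^sup>2) * c02) / (1 - t)
     + \<i> * k\<^sup>2 * c02 / (1 - t)\<^sup>2"
  proof -
    define s where "s = inverse (1 - t)"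
    define q where "q = inverse (1 - w)"
    have s: "s * (1 - t) = 1" and q: "q * (1 - w) = 1" using ne by (simp_all add: s_def q_def)
    have i: "\<i> * \<i> = -1" by simp
    \<comment> \<open>With \<open>s\<close> and \<open>q\<close> for the inverses, the claim follows from the polynomial relations above.\<close>
    show ?thesis
      unfolding k divide_inverse power_inverse[symmetric] power2_eq_square s_def[symmetric] q_def[symmetric] inverse_mult_distrib
      using s q i by algebra
  qed
  finally show ?thesis unfolding wt by simp
qed

text \<open>
  Since \<open>t\<close> has derivative \<open>- i t\<close> with respect to \<open>\<theta>\<close> and \<open>1/(1 - t) = 1 + t/(1 - t)\<close>, a primitive of
  \<open>1/(1 - t)\<close> is \<open>\<theta> - i Ln (1 - t)\<close>, and adding \<open>i/(1 - t)\<close> gives a primitive of \<open>1/(1 - t)\<^sup>2\<close>. The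
  principal logarithm is admissible because \<open>1 - t\<close> stays in the right half-plane. Apart from the
  linear term in \<open>\<theta>\<close>, the primitive takes the same value at \<open>- \<pi>\<close> and \<open>\<pi>\<close>; hence the two half-circles
  differ only in the sign of \<open>J\<close>.
\<close>

lemma half_circle_integrals:
  fixes r :: real and K1 Kt Kw K2 K3 k L J :: complex
  defines "k \<equiv> 1 - complex_of_real (r\<^sup>2)" and "L \<equiv> complex_of_real (ln (1 + r) - ln (1 - r))"
    and "g \<equiv> (\<lambda>\<theta>. K1 + Kt * (r * cis (- \<theta>)) + Kw * (r * cis \<theta>) + K2 / (1 - r * cis (- \<theta>))
       + K3 / (1 - r * cis (- \<theta>))\<^sup>2)"
  defines "J \<equiv> \<i> * (2 * r * (Kw - Kt) - (K2 + K3) * L - K3 * (2 * r / k))"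
  assumes r: "r \<in> {0<..<1}"
  shows "(g has_integral pi * (K1 + K2 + K3) + J) {0..pi}"
    and "(g has_integral pi * (K1 + K2 + K3) - J) {-pi..0}"
proof -
  define t where "t \<zeta> = r * exp (- \<i> * \<zeta>)" for \<zeta> :: complex
  define P where "P \<zeta> = K1 * \<zeta> + Kt * \<i> * t \<zeta> - Kw * \<i> * (r * exp (\<i> * \<zeta>)) + K2 * (\<zeta> - \<i> * Ln (1 - t \<zeta>))
      + K3 * (\<zeta> - \<i> * Ln (1 - t \<zeta>) + \<i> / (1 - t \<zeta>))" for \<zeta>
  have t: "t (of_real \<theta>) = r * cis (- \<theta>)" for \<theta> :: real
    by (simp add: t_def cis_conv_exp)
  have dP: "((\<lambda>\<theta>. P (of_real \<theta>)) has_vector_derivative g \<theta>) (at \<theta> within T)" for \<theta> T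
  proof (rule has_vector_derivative_real_field)
    have "Re (t \<theta>) < 1"
    proof -
      have "Re (t \<theta>) \<le> norm (t \<theta>)" by (rule complex_Re_le_cmod)
      also have "\<dots> < 1" using r by (simp add: t norm_mult)
      finally show ?thesis .
    qed
    then have nonneg: "1 - t \<theta> \<notin> \<real>\<^sub>\<le>\<^sub>0" and ne: "1 - t \<theta> \<noteq> 0"
      by (auto simp: complex_nonpos_Reals_iff)
    have dt: "(t has_field_derivative - \<i> * t \<theta>) (at \<theta>)"
      unfolding t_def[abs_def] by (auto intro!: derivative_eq_intros)
    have dLn: "((\<lambda>\<zeta>. Ln (1 - t \<zeta>)) has_field_derivative \<i> * t \<theta> / (1 - t \<theta>)) (at \<theta>)"
      by (rule dt derivative_eq_intros refl | use nonneg ne in \<open>simp add: divide_simps; fail\<close>)+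
    show "(P has_field_derivative g \<theta>) (at \<theta>)"
      unfolding P_def[abs_def]
      apply (rule dt dLn derivative_eq_intros refl | use ne in \<open>simp; fail\<close>)+
      unfolding g_def unfolding t[symmetric] unfolding cis_conv_exp using ne
      apply (simp add: divide_simps)
      apply (simp add: power2_eq_square algebra_simps)
      done
  qed
  have e: "exp (\<i> * of_real pi) = -1" "exp (- (\<i> * of_real pi)) = -1"
    by (simp_all add: exp_minus)
  have Ln: "Ln (1 + of_real r) = of_real (ln (1 + r))" "Ln (1 - of_real r) = of_real (ln (1 - r))"
    using r Ln_of_real[of "1 + r"] Ln_of_real[of "1 - r"] by auto
  have ne: "1 + complex_of_real r \<noteq> 0" "1 - complex_of_real r \<noteq> 0"
    using r by (auto simp: complex_eq_iff)
  have k: "k = (1 - of_real r) * (1 + of_real r)" by (simp add: k_def power2_eq_square algebra_simps)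
  \<comment> \<open>The increment of \<open>1/(1 - t)\<close>, where \<open>t\<close> goes from \<open>r\<close> to \<open>- r\<close>.\<close>
  have fr: "1 / (1 + complex_of_real r) - 1 / (1 - complex_of_real r) = - (2 * r / k)"
    unfolding k using ne by (simp add: divide_simps)
  have P0: "P 0 = Kt * \<i> * r - Kw * \<i> * r - (K2 + K3) * \<i> * of_real (ln (1 - r)) + K3 * \<i> * (1 / (1 - of_real r))"
    by (simp add: P_def t_def Ln algebra_simps)
  have Ppi: "P (of_real \<theta>) = \<theta> * (K1 + K2 + K3) - Kt * \<i> * r + Kw * \<i> * r
      - (K2 + K3) * \<i> * of_real (ln (1 + r)) + K3 * \<i> * (1 / (1 + of_real r))"
    if "\<theta> = pi \<or> \<theta> = -pi" for \<theta>
    using that by (elim disjE) (simp_all add: P_def t_def Ln e algebra_simps)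
  have d: "P (of_real \<theta>) - P (of_real 0) = \<theta> * (K1 + K2 + K3) + J" if "\<theta> = pi \<or> \<theta> = -pi" for \<theta>
  proof -
    have "P (of_real \<theta>) - P (of_real 0) = \<theta> * (K1 + K2 + K3) + \<i> * (2 * r * (Kw - Kt) - (K2 + K3) * L
        + K3 * (1 / (1 + complex_of_real r) - 1 / (1 - complex_of_real r)))"
      unfolding Ppi[OF that] of_real_0 P0 L_def by (simp add: algebra_simps)
    then show ?thesis unfolding fr J_def by simp
  qed
  show "(g has_integral pi * (K1 + K2 + K3) + J) {0..pi}"
    using fundamental_theorem_of_calculus[of 0 pi, OF _ dP] d[of pi] by simp
  have "P (of_real 0) - P (of_real (-pi)) = pi * (K1 + K2 + K3) - J"
    using d[of "-pi"] by (simp add: algebra_simps)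
  then show "(g has_integral pi * (K1 + K2 + K3) - J) {-pi..0}"
    using fundamental_theorem_of_calculus[of "-pi" 0, OF _ dP] by simp
qed


lemma field_at_surj: obtains X where "field_at X = f"
proof
  show "field_at (\<lambda>(x, y). (Re (f (Complex x y)), Im (f (Complex x y)))) = f"
    by (auto simp: field_at_def)
qed

text \<open>
  The part \<open>M\<close> common to both half-circles contains only \<open>r\<^sup>2\<close> and \<open>r\<^sup>4\<close>; the logarithms occur in \<open>J\<close>,
  which changes sign. Hence the averaged function contains the sums of the coefficients of the two
  half-planes in the terms from \<open>M\<close>, and their differences in the terms from \<open>J\<close>.
\<close>

lemma half_circle_radial_integrals:
  fixes r k L :: real and c00 c10 c01 c20 c11 c02 :: complex
  defines "k \<equiv> 1 - r\<^sup>2" and "L \<equiv> ln (1 + r) - ln (1 - r)"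
  assumes r: "r \<in> {0<..<1}" and X: "field_at X = quadratic_map c00 c10 c01 c20 c11 c02"
  defines "g \<equiv> (\<lambda>\<theta>. r * Re (cis (- \<theta>) * field_at (field_uv X) (r * cis \<theta>)))"
    and "M \<equiv> pi * (r\<^sup>2 * (Re c10 - 2 * Im c00) - r ^ 4 * (Re c01 + Im c11))"
    and "J \<equiv> - 2 * r * k * Re c00 + 2 * r ^ 3 * Im c10 + (2 * r - k\<^sup>2 * L) * Im c01
       - 2 * r ^ 3 * Re c20 - r\<^sup>2 * k * L * Re c11 + (2 * r + 2 * r * k - 2 * k * L) * Re c02"
  shows "(g has_integral M + J) {0..pi}" and "(g has_integral M - J) {-pi..0}"
proof -
  have k: "k \<noteq> 0" using one_minus_power2_pos[of r] r by (auto simp: k_def)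
  \<comment> \<open>The coefficients of the partial fraction decomposition.\<close>
  define K1 where "K1 = - \<i> * (- 2 * r\<^sup>2 * c00 + \<i> * r\<^sup>2 * c10 - \<i> * (1 - 2 * k) * c01 - r\<^sup>2 * c11 - 2 * k * c02)"
  define Kt where "Kt = - \<i> * (c00 + \<i> * c01 - c02)"
  define Kw where "Kw = - \<i> * (r\<^sup>2 * (c00 - \<i> * c10 - c20))"
  define K2 where "K2 = - \<i> * (- \<i> * k\<^sup>2 * c01 + r\<^sup>2 * k * c11 + (2 * k + k\<^sup>2) * c02)"
  define K3 where "K3 = \<i> * k\<^sup>2 * c02"
  define h where "h \<theta> = K1 + Kt * (r * cis (- \<theta>)) + Kw * (r * cis \<theta>) + K2 / (1 - r * cis (- \<theta>))
       + K3 / (1 - r * cis (- \<theta>))\<^sup>2" for \<theta>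
  define H where "H = \<i> * (2 * r * (Kw - Kt) - (K2 + K3) * L - K3 * (2 * r / k))"
  have g: "g \<theta> = Re (h \<theta>)" for \<theta>
  proof -
    have "r * (cis (- \<theta>) * field_at (field_uv X) (r * cis \<theta>)) = h \<theta>"
      unfolding radial_component_expansion[OF r X] h_def K1_def Kt_def Kw_def K2_def K3_def k_def
      by simp
    then have "Re (r * (cis (- \<theta>) * field_at (field_uv X) (r * cis \<theta>))) = Re (h \<theta>)" by (rule arg_cong)
    then show ?thesis by (simp add: g_def)
  qed
  have "K3 * (2 * r / k) = 2 * \<i> * (r * k * c02)"
    using k by (simp add: K3_def power2_eq_square)
  then have "Re H = J"
    unfolding H_def J_def K2_def Kt_def Kw_def
    by (simp add: K3_def algebra_simps eval_nat_numeral) (simp add: k_def algebra_simps eval_nat_numeral)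
  moreover have "Re (pi * (K1 + K2 + K3)) = M"
    unfolding K1_def K2_def K3_def M_def
    by (simp add: k_def algebra_simps eval_nat_numeral)
  moreover have "(h has_integral pi * (K1 + K2 + K3) + H) {0..pi}"
      "(h has_integral pi * (K1 + K2 + K3) - H) {-pi..0}"
    using half_circle_integrals[OF r, of K1 Kt Kw K2 K3]
    by (simp_all add: h_def[abs_def] H_def k_def L_def)
  moreover have "Re \<circ> h = g" using g by (simp add: fun_eq_iff)
  ultimately show "(g has_integral M + J) {0..pi}" "(g has_integral M - J) {-pi..0}"
    using has_integral_linear[OF _ bounded_linear_Re, of h "pi * (K1 + K2 + K3) + H" "{0..pi}"]
      has_integral_linear[OF _ bounded_linear_Re, of h "pi * (K1 + K2 + K3) - H" "{-pi..0}"]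
    by simp_all
qed

section \<open>The averaged functions are the six-parameter family\<close>

text \<open>
  The angles in \<open>(0,\<pi>)\<close> correspond to \<open>v > 0\<close>, that is \<open>x < 0\<close>, and so to \<open>X1m\<close> with coefficients \<open>d\<close>;
  the angles in \<open>(-\<pi>,0)\<close> belong to \<open>X1p\<close> with coefficients \<open>c\<close>. Expanding
  \<open>r\<^sup>3/(1 - r\<^sup>2) = r/(1 - r\<^sup>2) - r\<close> and \<open>r\<^sup>4/(1 - r\<^sup>2) = r\<^sup>2/(1 - r\<^sup>2) - r\<^sup>2\<close> brings the sum of the
  two half-circle integrals into the form of the family.
\<close>

lemma averaged1_eq_log_model:
  fixes c00 c10 c01 c20 c11 c02 d00 d10 d01 d20 d11 d02 :: complex
  assumes c: "field_at X1p = quadratic_map c00 c10 c01 c20 c11 c02"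
    and d: "field_at X1m = quadratic_map d00 d10 d01 d20 d11 d02"
    and r: "r \<in> {0<..<1}"
  shows "averaged1 X1p X1m X2p X2m r = (1 - r\<^sup>2) / r * log_model
     (2 * (Im (d01 - c01) + Re (d02 - c02) + Im (d10 - c10) - Re (d20 - c20)))
     (pi * (Re (d10 + c10) - 2 * Im (d00 + c00) - Re (d01 + c01) - Im (d11 + c11)))
     (2 * (Re (d20 - c20) + Re (d02 - c02) - Re (d00 - c00) - Im (d10 - c10)))
     (pi * (Re (d01 + c01) + Im (d11 + c11)))
     (- Im (d01 - c01) - 2 * Re (d02 - c02))
     (Im (d01 - c01) - Re (d11 - c11)) r" (is "_ = ?m")
proof -
  define k where "k = 1 - r\<^sup>2"
  have k: "k > 0" using one_minus_power2_pos[of r] r by (auto simp: k_def)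
  define L where "L = ln (1 + r) - ln (1 - r)"
  let ?F = "\<lambda>\<theta>. r * F1 X1p X1m X2p X2m \<theta> r"
  \<comment> \<open>At the end points the sine vanishes and \<open>F1\<close> uses \<open>X1m\<close>; this matters only on the lower half-circle.\<close>
  have up: "?F \<theta> = r * Re (cis (- \<theta>) * field_at (field_uv X1m) (r * cis \<theta>))" if "\<theta> \<in> {0..pi} - {}" for \<theta>
    unfolding F1_eq_Re[OF r] using sin_ge_zero[of \<theta>] that by simp
  have lo: "?F \<theta> = r * Re (cis (- \<theta>) * field_at (field_uv X1p) (r * cis \<theta>))" if "\<theta> \<in> {-pi..0} - {-pi, 0}" for \<theta>
    unfolding F1_eq_Re[OF r] using sin_gt_zero[of "- \<theta>"] that by simp
  note int_up = has_integral_spike_finite[OF finite.emptyI up half_circle_radial_integrals(1)[OF r d]]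
  have "finite {-pi, 0}" by simp
  note int_lo = has_integral_spike_finite[OF this lo half_circle_radial_integrals(2)[OF r c]]
  have ends: "-pi \<le> 0" "0 \<le> pi" by simp_all
  have model: "(1 - r\<^sup>2) / r * log_model A B C D a b r * r =
      A * r + B * r\<^sup>2 + (C * r + D * r\<^sup>2) * k + (a + b * r\<^sup>2) * k * L" for A B C D a b
    using r k by (simp add: log_model_def k_def[symmetric] L_def[symmetric] field_simps)
  have "averaged1 X1p X1m X2p X2m r * r = integral {-pi..pi} ?F"
    by (simp add: averaged1_def)
  also have "\<dots> = ?m * r"
    apply (rule integral_unique, rule has_integral_eq_rhs[OF has_integral_combine[OF ends int_lo int_up]])
    apply (assumption, assumption, subst model)
    apply (simp add: L_def[symmetric] k_def[symmetric])
    apply (simp add: k_def algebra_simps eval_nat_numeral)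
    done
  finally have eq: "averaged1 X1p X1m X2p X2m r * r = ?m * r" .
  have "r \<noteq> 0" using r by simp
  from iffD1[OF mult_right_cancel[OF this] eq] show ?thesis .
qed

lemma quadratic_field_averaged1:
  assumes "quadratic_field X1p" "quadratic_field X1m"
  obtains A B C D a b where "\<And>r X2p X2m. r \<in> {0<..<1} \<Longrightarrow>
    averaged1 X1p X1m X2p X2m r = (1 - r\<^sup>2) / r * log_model A B C D a b r"
proof -
  obtain c00 c10 c01 c20 c11 c02 where c: "field_at X1p = quadratic_map c00 c10 c01 c20 c11 c02"
    using quadratic_field_imp_quadratic_map[OF assms(1)] .
  obtain d00 d10 d01 d20 d11 d02 where d: "field_at X1m = quadratic_map d00 d10 d01 d20 d11 d02"
    using quadratic_field_imp_quadratic_map[OF assms(2)] .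
  show ?thesis by (rule that, rule averaged1_eq_log_model[OF c d])
qed

text \<open>
  A perturbation on the half-plane \<open>x < 0\<close> alone already realises every member of the family. Real
  coefficients in the basis of \<open>z\<close> and its conjugate suffice, and with them the six parameters
  form a triangular system that is solved by the coefficients of \<open>Y\<close>.
\<close>

lemma log_model_is_averaged1:
  obtains X1p X1m where "quadratic_field X1p" "quadratic_field X1m"
    "\<And>r X2p X2m. r \<in> {0<..<1} \<Longrightarrow>
       averaged1 X1p X1m X2p X2m r = (1 - r\<^sup>2) / r * log_model A B C D a b r"
proof -
  obtain X where X: "field_at X = quadratic_map 0 0 0 0 0 0" by (rule field_at_surj)
  obtain Y where Y: "field_at Y = quadratic_map (of_real (- (A + C) / 2 - a)) (of_real ((B + D) / pi))
      (of_real (D / pi)) (of_real (- (A + a) / 2)) (of_real (- b)) (of_real (- a / 2))"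
    by (rule field_at_surj)
  show ?thesis
  proof (rule that[of X Y])
    show "averaged1 X Y X2p X2m r = (1 - r\<^sup>2) / r * log_model A B C D a b r"
      if "r \<in> {0<..<1}" for r X2p X2m
    proof -
      have cong: "(1 - r\<^sup>2) / r * log_model A' B' C' D' a' b' r = (1 - r\<^sup>2) / r * log_model A B C D a b r"
        if "A' = A" "B' = B" "C' = C" "D' = D" "a' = a" "b' = b" for A' B' C' D' a' b'
        using that by simp
      show ?thesis
        unfolding averaged1_eq_log_model[OF X Y that]
        by (rule cong) (simp_all add: field_simps)
    qed
  qed (use X Y quadratic_map_imp_quadratic_field in blast)+
qed

section \<open>Simple zeros of the averaged function\<close>

text \<open>At a zero of the second factor, the product rule leaves only the derivative of that factor.\<close>

lemma averaged1_has_derivative: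
  assumes eq: "\<And>r. r \<in> {0<..<1} \<Longrightarrow> f r = (1 - r\<^sup>2) / r * log_model A B C D a b r"
    and x: "x \<in> {0<..<1}" "log_model A B C D a b x = 0"
  shows "(f has_real_derivative (1 - x\<^sup>2) / x * log_model' A B C D a b x) (at x)"
proof -
  have "((\<lambda>r. (1 - r\<^sup>2) / r * log_model A B C D a b r) has_real_derivative
      (1 - x\<^sup>2) / x * log_model' A B C D a b x) (at x)"
    by (rule log_model_deriv derivative_eq_intros refl | use x in \<open>simp; fail\<close>)+
  then show ?thesis
    by (rule has_field_derivative_transform_within_open[of _ _ _ "{0<..<1}"]) (use x eq in auto)
qed

theorem proposition3p1:
  shows "(\<forall>X1p X1m X2p X2m.
            quadratic_field X1p \<and> quadratic_field X1m \<and>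
            quadratic_field X2p \<and> quadratic_field X2m \<longrightarrow>
              finite (simple_zeros (averaged1 X1p X1m X2p X2m)) \<and>
              card (simple_zeros (averaged1 X1p X1m X2p X2m)) \<le> 5)
       \<and> (\<exists>X1p X1m X2p X2m.
            quadratic_field X1p \<and> quadratic_field X1m \<and>
            quadratic_field X2p \<and> quadratic_field X2m \<and>
              card (simple_zeros (averaged1 X1p X1m X2p X2m)) = 5)"
proof -
  have bound: "finite (simple_zeros f) \<and> card (simple_zeros f) \<le> 5"
    if eq: "\<And>r. r \<in> {0<..<1} \<Longrightarrow> f r = (1 - r\<^sup>2) / r * log_model A B C D a b r"
    for f A B C D a b
  proof (rule ccontr)
    have zero: "log_model A B C D a b x = 0" if "x \<in> simple_zeros f" for x
    proof -
      have "(1 - x\<^sup>2) / x * log_model A B C D a b x = 0" "1 - x\<^sup>2 > 0" "x \<noteq> 0"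
        using that eq[of x] one_minus_power2_pos[of x] by (auto simp: simple_zeros_def)
      then show ?thesis by simp
    qed
    assume "\<not> (finite (simple_zeros f) \<and> card (simple_zeros f) \<le> 5)"
    then have "infinite (simple_zeros f) \<or> 6 \<le> card (simple_zeros f)" by auto
    then obtain S where S: "finite S" "card S = 6" "S \<subseteq> simple_zeros f"
      by (meson infinite_arbitrarily_large obtain_subset_with_card_n)
    have "log_model' A B C D a b x = 0" if "x \<in> simple_zeros f" for x
    proof -
      have "A = 0 \<and> B = 0 \<and> C = 0 \<and> D = 0 \<and> a = 0 \<and> b = 0"
        by (rule log_model_six_zeros[OF S(1,2)]) (use S(3) zero in \<open>auto simp: simple_zeros_def\<close>)
      then show ?thesis by (simp add: log_model'_def)
    qed
    \<comment> \<open>Six zeros make \<open>f\<close> vanish identically, so none of them is simple.\<close>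
    then have "(f has_real_derivative 0) (at x)" if "x \<in> simple_zeros f" for x
      using averaged1_has_derivative[OF eq, of x] zero[OF that] that
      by (auto simp: simple_zeros_def)
    then have "simple_zeros f = {}" by (auto simp: simple_zeros_def dest: DERIV_unique)
    with S show False by simp
  qed
  \<comment> \<open>Any five points of \<open>(0,1)\<close> would do.\<close>
  define S :: "real set" where "S = (\<lambda>i. 1 / real (i + 2)) ` {..<5}"
  have S: "finite S" "card S = 5" "S \<subseteq> {0<..<1}"
    by (auto simp: S_def card_image inj_on_def)
  obtain A B C D a b where nz: "\<not> (A = 0 \<and> B = 0 \<and> C = 0 \<and> D = 0 \<and> a = 0 \<and> b = 0)"
    and zS: "\<forall>x\<in>S. log_model A B C D a b x = 0"
    using log_model_interpolation[OF S(1,2)] .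
  obtain X1p X1m where X: "quadratic_field X1p" "quadratic_field X1m"
    and eq: "\<And>r X2p X2m. r \<in> {0<..<1} \<Longrightarrow>
       averaged1 X1p X1m X2p X2m r = (1 - r\<^sup>2) / r * log_model A B C D a b r"
    by (rule log_model_is_averaged1[of A B C D a b]) (rule that)
  let ?f = "averaged1 X1p X1m X1p X1m"
  have eq_f: "?f r = (1 - r\<^sup>2) / r * log_model A B C D a b r" if "r \<in> {0<..<1}" for r
    using that by (rule eq)
  have "S \<subseteq> simple_zeros ?f"
  proof
    fix x assume x: "x \<in> S"
    then have x01: "x \<in> {0<..<1}" and z: "log_model A B C D a b x = 0" using S zS by auto
    have "log_model' A B C D a b x \<noteq> 0"
      using log_model_five_zeros_simple[OF S zS x] nz by blast
    then have "(1 - x\<^sup>2) / x * log_model' A B C D a b x \<noteq> 0"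
      using x01 one_minus_power2_pos[of x] by auto
    then show "x \<in> simple_zeros ?f"
      using averaged1_has_derivative[OF eq_f x01 z] eq_f[OF x01] x01 z unfolding simple_zeros_def by auto
  qed
  moreover have "finite (simple_zeros ?f) \<and> card (simple_zeros ?f) \<le> 5"
    using bound[OF eq_f] .
  ultimately have five: "card (simple_zeros ?f) = 5"
    using S(2) card_mono[of "simple_zeros ?f" S] by simp
  show ?thesis
  proof (rule conjI, intro allI impI)
    fix X1p X1m X2p X2m
    assume "quadratic_field X1p \<and> quadratic_field X1m \<and> quadratic_field X2p \<and> quadratic_field X2m"
    then have "quadratic_field X1p" "quadratic_field X1m" by simp_all
    then show "finite (simple_zeros (averaged1 X1p X1m X2p X2m)) \<and>
        card (simple_zeros (averaged1 X1p X1m X2p X2m)) \<le> 5"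
      by (rule quadratic_field_averaged1) (rule bound)
  next
    have "quadratic_field X1p \<and> quadratic_field X1m \<and>
        quadratic_field X1p \<and> quadratic_field X1m \<and> card (simple_zeros ?f) = 5"
      using X five by simp
    then show "\<exists>X1p X1m X2p X2m. quadratic_field X1p \<and> quadratic_field X1m \<and>
        quadratic_field X2p \<and> quadratic_field X2m \<and>
        card (simple_zeros (averaged1 X1p X1m X2p X2m)) = 5"
      by (intro exI)
  qed
qed

end
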